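(* Every non-empty finite set $D$ of integers is the signed degree set of some connected signed graph.
   Context: All graphs are finite, undirected, without loops and multiple edges. A signed graph is a graph in which each edge is assigned a positive or a negative sign. The signed degree of a vertex $v$ in a signed graph $G$, denoted $\mathrm{sdeg}(v)$, is the number of positive edges incident with $v$ minus the number of negative edges incident with $v$. The signed degree set of a signed graph $G$ is the set of distinct signed degrees of the vertices of $G$, i.e. $\{\mathrm{sdeg}(v) : v \in V(G)\}$. A signed graph is connected if its underlying graph (forgetting signs) is connected; the graph with one vertex is connected. *)

theory Defs
  imports "Graph_Theory.Digraph_Component"
begin

text \<open>
  A finite simple undirected graph is a \<^locale>\<open>pair_graph\<close>, i.e. a finite loop-free symmetric
  digraph, in which both arcs (u,v) and (v,u) stand for the one undirected edge {u,v}.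
  A signed graph is such a graph \<open>G\<close> together with a sign function on undirected edges, so that
  both arcs of an edge share one sign; the values of the sign function outside of
  \<open>undirected_edges G\<close> are irrelevant.
\<close>

datatype edge_sign = Positive | Negative

definition undirected_edges :: "'a pair_pre_digraph \<Rightarrow> 'a set set" where
  "undirected_edges G = {{u, v} | u v. (u, v) \<in> parcs G}"

definition sdeg :: "'a pair_pre_digraph \<Rightarrow> ('a set \<Rightarrow> edge_sign) \<Rightarrow> 'a \<Rightarrow> int" where
  "sdeg G \<sigma> v =
     int (card {e \<in> undirected_edges G. v \<in> e \<and> \<sigma> e = Positive})
   - int (card {e \<in> undirected_edges G. v \<in> e \<and> \<sigma> e = Negative})"

definition signed_degree_set :: "'a pair_pre_digraph \<Rightarrow> ('a set \<Rightarrow> edge_sign) \<Rightarrow> int set" where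
  "signed_degree_set G \<sigma> = {sdeg G \<sigma> v | v. v \<in> pverts G}"

end

theory Submission
  imports Defs "HOL-Number_Theory.Cong"
begin

text \<open>
  A signed graph is the same thing as a symmetric matrix with entries in \<open>{-1, 0, 1}\<close> and zero
  diagonal, and the signed degree of a vertex is its row sum (\<open>sdeg_weighted\<close>).  So the task is to
  find such a matrix whose set of row sums is \<open>D\<close> and whose nonzero entries connect all indices.

  Write \<open>D\<close> as the set of values of a list \<open>ds\<close> with at least two entries (repetitions are harmless,
  so a singleton \<open>D\<close> needs no separate treatment).  Let \<open>K\<close> be even with
  \<open>K \<ge> 2 * \<bar>d\<bar>\<close> for every \<open>d \<in> D\<close>, and cut the indices below \<open>length ds * K\<close> into consecutive blocks
  of \<open>K\<close> indices.  The blocks serve two independent purposes.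

  \<^item> Inside block number \<open>c\<close>, \<open>u\<close> and \<open>v\<close> are joined exactly when \<open>(u + v) mod K\<close> is one of the odd
    numbers below \<open>2 * \<bar>ds ! c\<bar>\<close>, always with the sign of \<open>ds ! c\<close>.  As \<open>u\<close> runs through a
    block, \<open>(u + v) mod K\<close> takes each residue once, so the row sum inside the block is \<open>ds ! c\<close>; and
    since \<open>u + u\<close> is even, there are no loops.

  \<^item> Indices \<open>u\<close> and \<open>v\<close> of different blocks are always joined, with sign \<open>(-1) ^ (u + v)\<close>.  A block
    has as many even as odd indices, so these edges cancel in every row sum; and with at least
    two blocks they make the graph connected.
\<close>

section \<open>Signed graphs from weight matrices\<close>

definition weighted_graph :: "'a set \<Rightarrow> ('a \<Rightarrow> 'a \<Rightarrow> int) \<Rightarrow> 'a pair_pre_digraph" where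
  "weighted_graph V w = \<lparr> pverts = V, parcs = {(u, v). u \<in> V \<and> v \<in> V \<and> w u v \<noteq> 0} \<rparr>"

definition weight_sign :: "('a \<Rightarrow> 'a \<Rightarrow> int) \<Rightarrow> 'a set \<Rightarrow> edge_sign" where
  "weight_sign w e = (if \<exists>u v. e = {u, v} \<and> w u v = 1 then Positive else Negative)"

lemma pair_graph_weighted_graph:
  assumes "finite V" "\<And>u v. w u v = w v u" "\<And>v. w v v = 0"
  shows "pair_graph (weighted_graph V w)"
proof
  have "parcs (weighted_graph V w) \<subseteq> V \<times> V"
    by (auto simp: weighted_graph_def)
  then show "finite (parcs (weighted_graph V w))"
    using assms(1) by (meson finite_SigmaI finite_subset)
  show "symmetric (with_proj (weighted_graph V w))"
    using assms(2) by (auto simp: weighted_graph_def symmetric_def sym_def)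
  show "fst e \<noteq> snd e" if "e \<in> parcs (weighted_graph V w)" for e
    using that assms(3) by (auto simp: weighted_graph_def)
qed (use assms(1) in \<open>auto simp: weighted_graph_def\<close>)

lemma weight_sign_edge:
  assumes "\<And>u v. w u v = w v u"
  shows "weight_sign w {u, v} = Positive \<longleftrightarrow> w u v = 1"
  unfolding weight_sign_def using assms by (auto simp: doubleton_eq_iff)

text \<open>
  The edges at \<open>v\<close> correspond to the other endpoint \<open>u\<close>, and a positive (negative) one
  contributes \<open>1\<close> (\<open>-1\<close>), which is its weight.
\<close>

lemma sdeg_weighted:
  fixes w :: "'a \<Rightarrow> 'a \<Rightarrow> int"
  assumes fin: "finite V" and v: "v \<in> V"
    and sym: "\<And>u v. w u v = w v u"
    and range: "\<And>u v. w u v \<in> {-1, 0, 1}"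
  shows "sdeg (weighted_graph V w) (weight_sign w) v = (\<Sum>u\<in>V. w v u)"
proof -
  let ?E = "undirected_edges (weighted_graph V w)"
  have bij: "card {e \<in> ?E. v \<in> e \<and> weight_sign w e = s}
      = card {u \<in> V. w v u \<noteq> 0 \<and> weight_sign w {v, u} = s}" for s
  proof -
    have "{e \<in> ?E. v \<in> e \<and> weight_sign w e = s}
        = (\<lambda>u. {v, u}) ` {u \<in> V. w v u \<noteq> 0 \<and> weight_sign w {v, u} = s}"
      using v sym by (auto simp: undirected_edges_def weighted_graph_def insert_commute)
    moreover have "inj (\<lambda>u. {v, u})"
      by (auto simp: inj_def doubleton_eq_iff)
    ultimately show ?thesis
      using card_image[OF inj_on_subset[OF _ subset_UNIV]] by auto
  qed
  have pos: "(w v u \<noteq> 0 \<and> weight_sign w {v, u} = Positive) \<longleftrightarrow> w v u = 1" for u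
    using weight_sign_edge[of w v u, OF sym] by auto
  have neg: "(w v u \<noteq> 0 \<and> weight_sign w {v, u} = Negative) \<longleftrightarrow> w v u = -1" for u
    using weight_sign_edge[of w v u, OF sym] range[of v u]
    by (cases "weight_sign w {v, u}") auto
  have "(\<Sum>u\<in>V. w v u) = (\<Sum>u\<in>V. of_bool (w v u = 1) - of_bool (w v u = -1))"
  proof (rule sum.cong)
    show "w v u = of_bool (w v u = 1) - of_bool (w v u = -1)" for u
      using range[of v u] by auto
  qed simp
  also have "\<dots> = int (card {u \<in> V. w v u = 1}) - int (card {u \<in> V. w v u = -1})"
    using fin by (simp add: sum_subtractf sum.If_cases of_bool_def Int_def)
  finally show ?thesis
    unfolding sdeg_def bij pos neg by simp
qed

lemma connected_weighted_graph:
  assumes sym: "\<And>u v. w u v = w v u" and ne: "V \<noteq> {}" and fin: "finite V" "\<And>v. w v v = 0"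
    and adj: "\<And>u v. u \<in> V \<Longrightarrow> v \<in> V \<Longrightarrow> w u v \<noteq> 0 \<or> (\<exists>x\<in>V. w u x \<noteq> 0 \<and> w x v \<noteq> 0)"
  shows "Digraph_Component.connected (with_proj (weighted_graph V w))"
proof -
  interpret pair_graph "weighted_graph V w"
    using fin sym by (intro pair_graph_weighted_graph)
  have arc: "u \<rightarrow>\<^sup>*\<^bsub>with_proj (weighted_graph V w)\<^esub> v"
    if "u \<in> V" "v \<in> V" "w u v \<noteq> 0" for u v
    using that by (intro reachable_adjI) (simp add: weighted_graph_def)
  have reach: "u \<rightarrow>\<^sup>*\<^bsub>with_proj (weighted_graph V w)\<^esub> v" if "u \<in> V" "v \<in> V" for u v
    using adj[OF that] arc that reachable_trans by metis
  show ?thesis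
    using ne reach reachable_mk_symmetricI
    by (intro connectedI) (auto simp: weighted_graph_def)
qed

section \<open>Sums over a block\<close>

text \<open>Translation by \<open>v\<close> permutes the residues modulo \<open>K\<close>, which a block represents once each.\<close>

lemma sum_block_mod:
  fixes g :: "nat \<Rightarrow> 'a::comm_monoid_add"
  assumes "K > 0"
  shows "(\<Sum>u\<in>{c * K..<c * K + K}. g ((u + v) mod K)) = (\<Sum>r<K. g r)"
proof -
  have inj: "inj_on (\<lambda>u. (u + v) mod K) {..<K}"
  proof (rule inj_onI)
    fix a b assume "a \<in> {..<K}" "b \<in> {..<K}" "(a + v) mod K = (b + v) mod K"
    then show "a = b"
      by (metis cong_add_rcancel_nat cong_def lessThan_iff mod_less)
  qed
  have "(\<lambda>u. (u + v) mod K) ` {..<K} = {..<K}"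
    using assms inj by (intro endo_inj_surj) auto
  with inj have bij: "bij_betw (\<lambda>u. (u + v) mod K) {..<K} {..<K}"
    by (simp add: bij_betw_def)
  have "(\<Sum>u\<in>{c * K..<c * K + K}. g ((u + v) mod K))
      = (\<Sum>u\<in>{0..<K}. g ((u + c * K + v) mod K))"
    using sum.shift_bounds_nat_ivl[of "\<lambda>u. g ((u + v) mod K)" 0 "c * K" K]
    by (simp add: add.commute)
  also have "\<dots> = (\<Sum>u<K. g ((u + v) mod K))"
  proof (rule sum.cong)
    fix u
    have "(u + c * K + v) mod K = (u + v + c * K) mod K"
      by (simp only: ac_simps)
    then show "g ((u + c * K + v) mod K) = g ((u + v) mod K)"
      by simp
  qed auto
  also have "\<dots> = (\<Sum>r<K. g r)"
    by (rule sum.reindex_bij_betw[OF bij])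
  finally show ?thesis .
qed

lemma sum_alternating_even: "(\<Sum>r<2 * M. (-1) ^ r) = (0::int)"
  by (induction M) auto

lemma sum_small_odd:
  fixes s :: int
  assumes "k \<le> M"
  shows "(\<Sum>r<2 * M. if odd r \<and> r < 2 * k then s else 0) = int k * s"
proof -
  have eq: "{..<2 * M} \<inter> {r. odd r \<and> r < 2 * k} = (\<lambda>i. 2 * i + 1) ` {..<k}"
    using assms by (auto elim!: oddE)
  have "card ((\<lambda>i::nat. 2 * i + 1) ` {..<k}) = k"
    by (subst card_image) (auto simp: inj_on_def)
  then show ?thesis
    by (simp add: sum.If_cases eq)
qed

section \<open>The block matrix\<close>

definition block_weight :: "nat \<Rightarrow> int list \<Rightarrow> nat \<Rightarrow> nat \<Rightarrow> int" where
  "block_weight K ds u v =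
     (if u div K = v div K
      then (let d = ds ! (u div K); r = (u + v) mod K
            in if odd r \<and> r < 2 * nat \<bar>d\<bar> then sgn d else 0)
      else (-1) ^ ((u + v) mod K))"

lemma block_weight_sym: "block_weight K ds u v = block_weight K ds v u"
  by (simp add: block_weight_def add.commute)

lemma block_weight_loop: "even K \<Longrightarrow> block_weight K ds v v = 0"
  by (simp add: block_weight_def Let_def dvd_mod)

lemma block_weight_range: "block_weight K ds u v \<in> {-1, 0, 1}"
  using neg_one_even_power neg_one_odd_power
  by (auto simp: block_weight_def Let_def sgn_if minus_one_power_iff)

lemma block_weight_row_sum:
  assumes K: "K = 2 * M" and M: "M > 0" and v: "v < length ds * K"
    and bound: "\<And>d. d \<in> set ds \<Longrightarrow> nat \<bar>d\<bar> \<le> M"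
  shows "(\<Sum>u<length ds * K. block_weight K ds v u) = ds ! (v div K)"
proof -
  have K0: "K > 0" and c: "v div K < length ds"
    using K M v by (auto simp: less_mult_imp_div_less)
  let ?d = "ds ! (v div K)"
  have block: "(\<Sum>u\<in>{c * K..<c * K + K}. block_weight K ds v u) = (if c = v div K then ?d else 0)"
    for c
  proof -
    have div: "u div K = c" if "u \<in> {c * K..<c * K + K}" for u
      using that K0 by (intro div_nat_eqI) (auto simp: ac_simps)
    define g :: "nat \<Rightarrow> int" where
      "g r = (if c = v div K then if odd r \<and> r < 2 * nat \<bar>?d\<bar> then sgn ?d else 0 else (-1) ^ r)"
      for r
    have "(\<Sum>u\<in>{c * K..<c * K + K}. block_weight K ds v u)
        = (\<Sum>u\<in>{c * K..<c * K + K}. g ((u + v) mod K))"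
    proof (rule sum.cong)
      fix u assume "u \<in> {c * K..<c * K + K}"
      then have "u div K = c"
        by (rule div)
      then show "block_weight K ds v u = g ((u + v) mod K)"
        unfolding block_weight_def g_def Let_def add.commute[of v u] by simp
    qed simp
    also have "\<dots> = (\<Sum>r<K. g r)"
      by (rule sum_block_mod[OF K0])
    also have "\<dots> = (if c = v div K then ?d else 0)"
      using sum_small_odd[of "nat \<bar>?d\<bar>" M "sgn ?d"] bound[of ?d] c sum_alternating_even[of M]
      by (auto simp: g_def K abs_mult_sgn)
    finally show ?thesis .
  qed
  have "(\<Sum>u<length ds * K. block_weight K ds v u)
      = (\<Sum>c<length ds. \<Sum>u\<in>{c * K..<c * K + K}. block_weight K ds v u)"
    by (rule sum.nat_group[symmetric])
  also have "\<dots> = ?d"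
    using c by (simp add: block)
  finally show ?thesis .
qed

text \<open>
  Any two indices of different blocks are adjacent, and two indices of one block have a common
  neighbour in any other block.
\<close>

lemma block_weight_common_neighbour:
  assumes K: "K > 0" and len: "length ds \<ge> 2"
  shows "block_weight K ds u v \<noteq> 0
    \<or> (\<exists>x\<in>{..<length ds * K}. block_weight K ds u x \<noteq> 0 \<and> block_weight K ds x v \<noteq> 0)"
proof (cases "u div K = v div K")
  case True
  define b :: nat where "b = (if u div K = 0 then 1 else 0)"
  have "b * K < length ds * K" "(b * K) div K \<noteq> u div K"
    using K len by (auto simp: b_def)
  with True show ?thesis
    by (intro disjI2 bexI[of _ "b * K"]) (auto simp: block_weight_def)
qed (simp add: block_weight_def)

section \<open>Realising a set of integers\<close>

theorem theorem2p3:
  fixes D :: "int set"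
  assumes "finite D" and "D \<noteq> {}"
  shows "\<exists>(G :: nat pair_pre_digraph) (\<sigma> :: nat set \<Rightarrow> edge_sign).
           pair_graph G \<and> Digraph_Component.connected (with_proj G) \<and> signed_degree_set G \<sigma> = D"
proof -
  obtain xs where xs: "set xs = D"
    using assms(1) finite_list by blast
  \<comment> \<open>Each value gets two blocks: one block on its own need not be connected.\<close>
  define ds where "ds = xs @ xs"
  have ds: "set ds = D" "length ds \<ge> 2"
    using xs assms(2) by (cases xs; auto simp: ds_def)+
  define M where "M = Suc (\<Sum>d\<in>D. nat \<bar>d\<bar>)"
  define K where "K = 2 * M"
  have bound: "nat \<bar>d\<bar> \<le> M" if "d \<in> set ds" for d
    using member_le_sum[of d D "\<lambda>d. nat \<bar>d\<bar>"] that ds(1) assms(1) by (simp add: M_def)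
  have K: "K > 0" "even K" "M > 0"
    by (simp_all add: K_def M_def)
  let ?V = "{..<length ds * K}"
  let ?w = "block_weight K ds"
  note w = block_weight_sym[of K ds] block_weight_loop[OF K(2), of ds]
  have sdeg: "sdeg (weighted_graph ?V ?w) (weight_sign ?w) v = ds ! (v div K)" if "v \<in> ?V" for v
    using sdeg_weighted[OF _ that w(1) block_weight_range] that
      block_weight_row_sum[OF K_def K(3) _ bound] by simp
  have blocks: "(\<lambda>v. v div K) ` ?V = {..<length ds}"
  proof
    show "{..<length ds} \<subseteq> (\<lambda>v. v div K) ` ?V"
      using K(1) by (auto intro!: image_eqI[where x = "c * K" for c])
  qed (auto simp: less_mult_imp_div_less)
  have "signed_degree_set (weighted_graph ?V ?w) (weight_sign ?w)
      = sdeg (weighted_graph ?V ?w) (weight_sign ?w) ` ?V"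
    unfolding signed_degree_set_def by (auto simp: weighted_graph_def)
  also have "\<dots> = (\<lambda>v. ds ! (v div K)) ` ?V"
    using sdeg by (rule image_cong[OF refl])
  also have "\<dots> = (!) ds ` {..<length ds}"
    by (simp add: image_image flip: blocks)
  also have "\<dots> = D"
    using ds(1) by (auto simp: set_conv_nth)
  finally have "signed_degree_set (weighted_graph ?V ?w) (weight_sign ?w) = D" .
  moreover have "pair_graph (weighted_graph ?V ?w)"
    by (rule pair_graph_weighted_graph[OF _ w]) simp
  moreover have "Digraph_Component.connected (with_proj (weighted_graph ?V ?w))"
  proof (rule connected_weighted_graph[OF w(1) _ _ w(2)])
    show "?V \<noteq> {}"
      using K(1) ds(2) by (auto simp: lessThan_empty_iff)
  qed (use block_weight_common_neighbour[OF K(1) ds(2)] in auto)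
  ultimately show ?thesis
    by blast
qed

end
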